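(* Let $\mathbb{X}$ be a nonzero finite-dimensional real Banach space, let $m\ge1$, and let $\mathcal{A}\subset\mathbb{X}\setminus\{0\}$ be a compact set such that for every nonzero $x\in\mathbb{X}$ there exists $r_x>0$ with $r_x x\in\mathcal{A}$. Then the following are equivalent: (i) $\mathcal{A}$ admits a ball covering consisting of $m$ balls; (ii) there exist $x_1,\dots,x_m\in Sm(\mathbb{X})$ such that $\bigcap_{i=1}^m x_i^-=\{0\}$; (iii) there exist $y_1,\dots,y_m\in\mathbb{X}\setminus\{0\}$ such that $\bigcap_{i=1}^m y_i^-=\{0\}$; (iv) there exist $z_1,\dots,z_m\in\mathbb{X}\setminus\{0\}$ such that $\bigcap_{i=1}^m z_i^+=\{0\}$; (v) there exist exposed points $f_1,\dots,f_m\in S_{\mathbb{X}^*}$ of $B_{\mathbb{X}^*}$ such that $\bigcap_{i=1}^m\{y\in\mathbb{X}: f_i(y)\le0\}=\{0\}$.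
   Context: $B_{\mathbb{Z}}$ and $S_{\mathbb{Z}}$ denote the closed unit ball and unit sphere of $\mathbb{Z}$. A set $\mathcal{A}\subset\mathbb{X}$ admits a ball covering consisting of $m$ balls if there are $x_1,\dots,x_m\in\mathbb{X}\setminus\{0\}$ and $0<r_i\le\|x_i\|$ with $\mathcal{A}\subseteq\bigcup_{i=1}^m B(x_i,r_i)$, where $B(x,r)$ is the open ball of center $x$ and radius $r$. For $x\in\mathbb{X}$: $x^+:=\{y\in\mathbb{X}:\|x+\lambda y\|\ge\|x\|\ \forall\lambda\ge0\}$ and $x^-:=\{y\in\mathbb{X}:\|x+\lambda y\|\ge\|x\|\ \forall\lambda\le0\}$. For nonzero $x$, $J(x):=\{x^*\in S_{\mathbb{X}^*}:x^*(x)=\|x\|\}$; $x$ is smooth if $J(x)$ is a singleton, and $Sm(\mathbb{X})$ is the set of (nonzero) smooth points. A point $u\in S_{\mathbb{Z}}$ is an exposed point of $B_{\mathbb{Z}}$ if there is $u^*\in S_{\mathbb{Z}^*}$ with $u^*(u)=1$ and $u^*(v)<1$ for all $v\in S_{\mathbb{Z}}\setminus\{u\}$. *)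

theory Defs
  imports "HOL-Analysis.Analysis"
begin

text \<open>
  The norm of the ambient space is arbitrary, so spaces are types of class
  \<^class>\<open>real_normed_vector\<close> (the norm of \<^class>\<open>euclidean_space\<close> would be Euclidean), the
  dual of \<open>'a\<close> is the type \<open>'a \<Rightarrow>\<^sub>L real\<close> with the operator norm, and finite dimension is the
  existence of a finite spanning set.
\<close>

definition finite_dim :: "'a::real_vector itself \<Rightarrow> bool" where
  "finite_dim _ \<longleftrightarrow> (\<exists>B::'a set. finite B \<and> span B = UNIV)"

text \<open>The centres and radii are indexed by \<open>1, \<dots>, m\<close>; repetitions are allowed.\<close>

definition admits_ball_covering :: "nat \<Rightarrow> 'a::real_normed_vector set \<Rightarrow> bool" where
  "admits_ball_covering m A \<longleftrightarrow>
     (\<exists>(x :: nat \<Rightarrow> 'a) (r :: nat \<Rightarrow> real).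
        (\<forall>i\<in>{1..m}. x i \<noteq> 0 \<and> 0 < r i \<and> r i \<le> norm (x i)) \<and>
        A \<subseteq> (\<Union>i\<in>{1..m}. ball (x i) (r i)))"

definition plus_part :: "'a::real_normed_vector \<Rightarrow> 'a set" where
  "plus_part x = {y. \<forall>t::real. t \<ge> 0 \<longrightarrow> norm (x + t *\<^sub>R y) \<ge> norm x}"

definition minus_part :: "'a::real_normed_vector \<Rightarrow> 'a set" where
  "minus_part x = {y. \<forall>t::real. t \<le> 0 \<longrightarrow> norm (x + t *\<^sub>R y) \<ge> norm x}"

definition support_functionals :: "'a::real_normed_vector \<Rightarrow> ('a \<Rightarrow>\<^sub>L real) set" where
  "support_functionals x = {f \<in> sphere 0 1. blinfun_apply f x = norm x}"

definition smooth_points :: "'a::real_normed_vector set" where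
  "smooth_points = {x. x \<noteq> 0 \<and> is_singleton (support_functionals x)}"

definition exposed_points_unit_ball :: "'z::real_normed_vector set" where
  "exposed_points_unit_ball =
     {u \<in> sphere 0 1. \<exists>g :: 'z \<Rightarrow>\<^sub>L real. g \<in> sphere 0 1 \<and> blinfun_apply g u = 1 \<and>
        (\<forall>v \<in> sphere 0 1 - {u}. blinfun_apply g v < 1)}"

end

theory Submission
  imports Defs
begin

text \<open>
  The link between the geometric and the algebraic conditions is that \<open>y\<close> lies outside
  \<open>minus_part x\<close> exactly when some positive multiple of \<open>y\<close> lies in the open ball about \<open>x\<close> with
  radius \<open>norm x\<close> (\<open>not_in_minus_part_iff\<close>). So \<open>\<Inter>i. minus_part (y i) = {0}\<close> says that every ray
  from the origin meets one of the balls \<open>B(y i, norm (y i))\<close>. A covering of \<open>A\<close> gives this at once,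
  since \<open>A\<close> meets every ray. For the converse, the balls \<open>B(s y, s norm y)\<close> grow with \<open>s\<close> and exhaust
  the open cone generated by \<open>B(y, norm y)\<close>, so by compactness one common factor \<open>s\<close> serves for
  all of \<open>A\<close> (\<open>compact_covered_by_dilated_balls\<close>). Replacing \<open>y\<close> by \<open>- y\<close> exchanges the sets \<open>minus_part y\<close>
  and \<open>plus_part y\<close>.

  Compactness even leaves some room: the radii may be reduced by \<open>1 / s\<close>. Hence the centres
  \<open>s y i\<close> may be moved a little without losing the covering of the unit sphere, and they become smooth
  because smooth points are dense (\<open>smooth_points_dense\<close>). A smooth point near \<open>x0\<close> is found by maximising
  \<open>norm z - k * Q (z - x0)\<close> for a positive definite quadratic form \<open>Q\<close> and a large \<open>k\<close>. At a maximum
  the norm is touched from above by a differentiable function, while every support functional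
  touches it from below, so there is only one support functional.

  Finally, \<open>y \<in> minus_part x\<close> holds exactly when some \<open>f \<in> J(x)\<close> satisfies \<open>f y \<le> 0\<close>
  (\<open>minus_part_iff_support\<close>), so \<open>minus_part x\<close> is a closed half space when \<open>J(x) = {f}\<close>. By reflexivity the
  functionals \<open>f\<close> that occur in this way are exactly the exposed points of the dual unit ball:
  a functional on the dual that exposes \<open>f\<close> is evaluation at a point \<open>x\<close>, and the
  functionals where it attains its maximum on the dual ball are those of \<open>J(x)\<close>.

  The two ingredients that come from finite dimension, apart from compactness, are a Hahn-Banach
  theorem (\<open>Hahn_Banach_finite_dim\<close>) and reflexivity (\<open>finite_dim_reflexive\<close>). Compactness of the unit
  sphere is read off from \<open>A\<close>, which the radial projection maps onto the sphere.
\<close>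

section \<open>Linear functionals below sublinear functionals\<close>

definition sublinear :: "('a::real_vector \<Rightarrow> real) \<Rightarrow> bool" where
  "sublinear p \<longleftrightarrow> (\<forall>v w. p (v + w) \<le> p v + p w) \<and> (\<forall>c\<ge>0. \<forall>v. p (c *\<^sub>R v) = c * p v)"

lemma sublinear_add: "sublinear p \<Longrightarrow> p (v + w) \<le> p v + p w"
  and sublinear_scale: "sublinear p \<Longrightarrow> c \<ge> 0 \<Longrightarrow> p (c *\<^sub>R v) = c * p v"
  by (auto simp: sublinear_def)

lemma sublinear_0: "sublinear p \<Longrightarrow> p 0 = 0"
  using sublinear_scale[of p 0 0] by simp

lemma sublinear_minus: "sublinear p \<Longrightarrow> 0 \<le> p v + p (- v)"
  using sublinear_add[of p v "- v"] by (simp add: sublinear_0)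

lemma sublinear_norm: "sublinear (norm :: 'a::real_normed_vector \<Rightarrow> real)"
  by (simp add: sublinear_def norm_triangle_ineq)

text \<open>
  For \<open>p = norm\<close> this is the one-sided directional derivative of the norm at \<open>y\<close> in the direction \<open>v\<close>,
  written with \<open>t\<close> large instead of a small step \<open>1 / t\<close>. In general it is a smaller
  sublinear function that has become linear along the line through \<open>y\<close> and still equals \<open>p\<close> at \<open>y\<close>.
\<close>
definition straighten :: "('a::real_vector \<Rightarrow> real) \<Rightarrow> 'a \<Rightarrow> 'a \<Rightarrow> real" where
  "straighten p y v = (INF t\<in>{0..}. p (v + t *\<^sub>R y) - t * p y)"

context
  fixes p :: "'a::real_vector \<Rightarrow> real" and y :: 'a
  assumes p: "sublinear p"
begin

lemma straighten_bounded_below: "t \<ge> 0 \<Longrightarrow> - p (- v) \<le> p (v + t *\<^sub>R y) - t * p y"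
  using sublinear_add[OF p, of "v + t *\<^sub>R y" "- v"] by (simp add: sublinear_scale[OF p])

lemma straighten_le: "t \<ge> 0 \<Longrightarrow> straighten p y v \<le> p (v + t *\<^sub>R y) - t * p y"
  unfolding straighten_def
  by (rule cINF_lower) (auto intro!: bdd_belowI2[of _ "- p (- v)"] straighten_bounded_below)

lemma straighten_greatest:
  "(\<And>t. t \<ge> 0 \<Longrightarrow> c \<le> p (v + t *\<^sub>R y) - t * p y) \<Longrightarrow> c \<le> straighten p y v"
  unfolding straighten_def by (rule cINF_greatest) auto

lemma straighten_le_self: "straighten p y v \<le> p v"
  using straighten_le[of 0 v] by simp

lemma straighten_minus_direction: "straighten p y (- y) \<le> - p y"
  using straighten_le[of 1 "- y"] by (simp add: sublinear_0[OF p])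

lemma straighten_add: "straighten p y (v + w) \<le> straighten p y v + straighten p y w"
proof -
  have "straighten p y (v + w) - (p (w + t *\<^sub>R y) - t * p y) \<le> straighten p y v" if t: "t \<ge> 0" for t
  proof (rule straighten_greatest)
    fix s :: real assume s: "s \<ge> 0"
    have "straighten p y (v + w) \<le> p ((v + w) + (s + t) *\<^sub>R y) - (s + t) * p y"
      using s t by (intro straighten_le) simp
    also have "(v + w) + (s + t) *\<^sub>R y = (v + s *\<^sub>R y) + (w + t *\<^sub>R y)"
      by (simp add: algebra_simps)
    also have "p \<dots> \<le> p (v + s *\<^sub>R y) + p (w + t *\<^sub>R y)"
      by (rule sublinear_add[OF p])
    finally show "straighten p y (v + w) - (p (w + t *\<^sub>R y) - t * p y) \<le> p (v + s *\<^sub>R y) - s * p y"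
      by (simp add: algebra_simps)
  qed
  then have "straighten p y (v + w) - straighten p y v \<le> straighten p y w"
    by (intro straighten_greatest) (simp add: algebra_simps)
  then show ?thesis by simp
qed

lemma straighten_scale_le:
  assumes c: "c > 0" shows "straighten p y (c *\<^sub>R v) \<le> c * straighten p y v"
proof -
  have "straighten p y (c *\<^sub>R v) / c \<le> straighten p y v"
  proof (rule straighten_greatest)
    fix t :: real assume t: "t \<ge> 0"
    have "straighten p y (c *\<^sub>R v) \<le> p (c *\<^sub>R v + (c * t) *\<^sub>R y) - (c * t) * p y"
      using c t by (intro straighten_le) simp
    also have "c *\<^sub>R v + (c * t) *\<^sub>R y = c *\<^sub>R (v + t *\<^sub>R y)"
      by (simp add: algebra_simps)
    also have "p \<dots> = c * p (v + t *\<^sub>R y)"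
      using c by (intro sublinear_scale[OF p]) simp
    also have "c * p (v + t *\<^sub>R y) - (c * t) * p y = c * (p (v + t *\<^sub>R y) - t * p y)"
      by (simp add: algebra_simps)
    finally show "straighten p y (c *\<^sub>R v) / c \<le> p (v + t *\<^sub>R y) - t * p y"
      using c by (simp add: field_simps)
  qed
  then show ?thesis using c by (simp add: field_simps)
qed

lemma sublinear_straighten: "sublinear (straighten p y)"
proof -
  have "straighten p y 0 = 0"
  proof (rule antisym)
    show "straighten p y 0 \<le> 0"
      using straighten_le_self[of 0] by (simp only: sublinear_0[OF p])
    show "0 \<le> straighten p y 0"
      by (rule straighten_greatest) (simp add: sublinear_scale[OF p])
  qed
  moreover have "straighten p y (c *\<^sub>R v) = c * straighten p y v" if c: "c > 0" for c v
  proof (rule antisym)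
    show "straighten p y (c *\<^sub>R v) \<le> c * straighten p y v"
      by (rule straighten_scale_le[OF c])
    have "straighten p y v \<le> inverse c * straighten p y (c *\<^sub>R v)"
      using straighten_scale_le[of "inverse c" "c *\<^sub>R v"] c by simp
    then show "c * straighten p y v \<le> straighten p y (c *\<^sub>R v)"
      using c by (simp add: field_simps)
  qed
  ultimately have "straighten p y (c *\<^sub>R v) = c * straighten p y v" if "c \<ge> 0" for c v
    using that by (cases "c = 0") simp_all
  then show ?thesis
    unfolding sublinear_def using straighten_add by blast
qed

end

text \<open>
  Straightening in one direction does not spoil the directions treated before: the
  quantity \<open>q b + q (- b)\<close> only decreases when \<open>q\<close> does.
\<close>
lemma exists_straightened_on_finite:
  assumes "finite B" "sublinear p"
  shows "\<exists>q. sublinear q \<and> (\<forall>v. q v \<le> p v) \<and> (\<forall>b\<in>B. q b + q (- b) \<le> 0)"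
  using assms
proof (induction B)
  case empty
  then show ?case by auto
next
  case (insert b B)
  then obtain q where q: "sublinear q" "\<And>v. q v \<le> p v" "\<And>b. b \<in> B \<Longrightarrow> q b + q (- b) \<le> 0"
    by blast
  let ?q = "straighten q b"
  have le: "?q v \<le> q v" for v
    by (rule straighten_le_self[OF q(1)])
  have neg: "?q c + ?q (- c) \<le> 0" if "c \<in> insert b B" for c
  proof (cases "c = b")
    case True
    then show ?thesis
      using le[of b] straighten_minus_direction[OF q(1), of b] by simp
  next
    case False
    then show ?thesis
      using that q(3)[of c] le[of c] le[of "- c"] by auto
  qed
  then show ?case
  proof (intro exI[of _ ?q] conjI allI ballI)
    show "sublinear ?q" by (rule sublinear_straighten[OF q(1)])
    show "?q v \<le> p v" for v using le[of v] q(2)[of v] by linarith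
    show "?q c + ?q (- c) \<le> 0" if "c \<in> insert b B" for c using that by (rule neg)
  qed
qed

text \<open>
  The vectors along which a sublinear function is odd form a subspace, and
  an odd sublinear function is linear.
\<close>
lemma linear_if_straight_on_spanning:
  assumes q: "sublinear q" and B: "span B = UNIV" "\<And>b. b \<in> B \<Longrightarrow> q b + q (- b) \<le> 0"
  shows "linear q"
proof -
  let ?S = "{v. q v + q (- v) \<le> 0}"
  have "subspace ?S"
    unfolding subspace_def
  proof (intro conjI ballI allI)
    show "0 \<in> ?S" by (simp add: sublinear_0[OF q])
  next
    fix v w assume "v \<in> ?S" "w \<in> ?S"
    then show "v + w \<in> ?S"
      using sublinear_add[OF q, of v w] sublinear_add[OF q, of "- v" "- w"] by simp
  next
    fix c :: real and v assume v: "v \<in> ?S"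
    have "q (c *\<^sub>R v) + q (- (c *\<^sub>R v)) = \<bar>c\<bar> * (q v + q (- v))"
      using sublinear_scale[OF q, of "\<bar>c\<bar>" v] sublinear_scale[OF q, of "\<bar>c\<bar>" "- v"]
      by (cases "c \<ge> 0") (simp_all add: algebra_simps)
    then show "c *\<^sub>R v \<in> ?S"
      using v by (simp add: mult_le_0_iff)
  qed
  moreover have "B \<subseteq> ?S" using B(2) by auto
  ultimately have "v \<in> ?S" for v
    using span_minimal[of B ?S] B(1) by auto
  then have odd: "q (- v) = - q v" for v
    using sublinear_minus[OF q, of v] by (smt (verit) mem_Collect_eq)
  show ?thesis
  proof (rule linearI)
    fix v w
    show "q (v + w) = q v + q w"
      using sublinear_add[OF q, of v w] sublinear_add[OF q, of "- v" "- w"] odd[of v] odd[of w]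
        odd[of "v + w"] by simp
  next
    fix c :: real and v
    show "q (c *\<^sub>R v) = c *\<^sub>R q v"
      using sublinear_scale[OF q, of c v] sublinear_scale[OF q, of "- c" v] odd[of "c *\<^sub>R v"]
      by (cases "c \<ge> 0") auto
  qed
qed

text \<open>
  Straightening first along \<open>y\<close> pins the value at \<open>y\<close>, because it forces \<open>f (- y) \<le> - p y\<close>; straightening along
  the members of a finite spanning set then makes the function linear.
\<close>
lemma Hahn_Banach_finite_dim:
  fixes p :: "'a::real_vector \<Rightarrow> real"
  assumes fin: "finite_dim TYPE('a)" and p: "sublinear p"
  shows "\<exists>f. linear f \<and> (\<forall>v. f v \<le> p v) \<and> f y = p y"
proof -
  obtain B :: "'a set" where B: "finite B" "span B = UNIV"
    using fin unfolding finite_dim_def by blast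
  obtain f where f: "sublinear f" "\<And>v. f v \<le> straighten p y v" "\<And>b. b \<in> B \<Longrightarrow> f b + f (- b) \<le> 0"
    using exists_straightened_on_finite[OF B(1) sublinear_straighten[OF p]] by blast
  have lin: "linear f"
    by (rule linear_if_straight_on_spanning[OF f(1) B(2) f(3)])
  have le: "f v \<le> p v" for v
    using f(2) straighten_le_self[OF p] by (rule order_trans)
  have "- f y \<le> - p y"
    using f(2)[of "- y"] straighten_minus_direction[OF p, of y] linear_neg[OF lin, of y] by simp
  then show ?thesis
    using lin le[of y] le by (intro exI[of _ f]) auto
qed

section \<open>Support functionals\<close>

lemma blinfun_of_dominated_linear:
  fixes h :: "'a::real_normed_vector \<Rightarrow> real"
  assumes lin: "linear h" and le: "\<And>v. h v \<le> norm v"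
  shows "\<exists>f :: 'a \<Rightarrow>\<^sub>L real. blinfun_apply f = h \<and> norm f \<le> 1"
proof -
  have abs: "norm (h v) \<le> norm v" for v
    using le[of v] le[of "- v"] linear_neg[OF lin, of v] by (simp add: abs_le_iff)
  have "bounded_linear h"
    using lin abs by (intro bounded_linear_intro[of _ 1]) (auto simp: linear_add linear_scale)
  then have ap: "blinfun_apply (Blinfun h) = h"
    by (rule bounded_linear_Blinfun_apply)
  moreover have "norm (Blinfun h) \<le> 1"
    by (rule norm_blinfun_bound) (use abs in \<open>simp_all add: ap\<close>)
  ultimately show ?thesis by blast
qed

lemma blinfun_le_norm:
  fixes f :: "'a::real_normed_vector \<Rightarrow>\<^sub>L real"
  assumes "norm f \<le> 1" shows "blinfun_apply f v \<le> norm v"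
proof -
  have "\<bar>blinfun_apply f v\<bar> \<le> norm f * norm v"
    using norm_blinfun[of f v] by simp
  also have "\<dots> \<le> 1 * norm v"
    using assms by (intro mult_right_mono) auto
  finally show ?thesis by simp
qed

lemma support_functionalsI:
  fixes f :: "'a::real_normed_vector \<Rightarrow>\<^sub>L real"
  assumes "norm f \<le> 1" "blinfun_apply f x = norm x" "x \<noteq> 0"
  shows "f \<in> support_functionals x"
proof -
  have "norm x \<le> norm f * norm x"
    using norm_blinfun[of f x] assms(2) by simp
  then have "norm f \<ge> 1" using assms(3) by simp
  then show ?thesis using assms by (simp add: support_functionals_def)
qed

lemma support_functionals_nonempty:
  fixes x :: "'a::real_normed_vector"
  assumes fin: "finite_dim TYPE('a)" and x: "x \<noteq> 0"
  shows "\<exists>f. f \<in> support_functionals x"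
proof -
  obtain h where h: "linear h" "\<And>v. h v \<le> norm v" "h x = norm x"
    using Hahn_Banach_finite_dim[OF fin sublinear_norm, of x] by blast
  obtain f :: "'a \<Rightarrow>\<^sub>L real" where f: "blinfun_apply f = h" "norm f \<le> 1"
    using blinfun_of_dominated_linear[OF h(1,2)] by blast
  then have "f \<in> support_functionals x"
    using h(3) x by (intro support_functionalsI) simp_all
  then show ?thesis ..
qed

text \<open>
  The norm does not decrease from \<open>x\<close> in the direction \<open>- y\<close> iff its one-sided derivative there
  is nonnegative. That derivative \<open>q\<close> is sublinear, so some linear \<open>h \<le> q\<close> agrees with it at \<open>- y\<close>.
  From \<open>q (- x) \<le> - norm x\<close> it follows that \<open>h\<close> also supports the norm at \<open>x\<close>.
\<close>
lemma minus_part_iff_support: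
  fixes x :: "'a::real_normed_vector"
  assumes fin: "finite_dim TYPE('a)" and x: "x \<noteq> 0"
  shows "y \<in> minus_part x \<longleftrightarrow> (\<exists>f\<in>support_functionals x. blinfun_apply f y \<le> 0)"
proof
  assume y: "y \<in> minus_part x"
  let ?q = "straighten norm x"
  have q: "sublinear ?q" by (rule sublinear_straighten[OF sublinear_norm])
  have "0 \<le> ?q (- y)"
  proof (rule straighten_greatest[OF sublinear_norm])
    fix t :: real assume t: "t \<ge> 0"
    show "0 \<le> norm (- y + t *\<^sub>R x) - t * norm x"
    proof (cases "t = 0")
      case False
      with t have t: "t > 0" by simp
      have "\<forall>s\<le>0. norm x \<le> norm (x + s *\<^sub>R y)"
        using y by (simp add: minus_part_def)
      moreover have "- inverse t \<le> 0" using t by simp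
      ultimately have "norm x \<le> norm (x + (- inverse t) *\<^sub>R y)" by blast
      then have "t * norm x \<le> t * norm (x + (- inverse t) *\<^sub>R y)"
        using t by (intro mult_left_mono) auto
      also have "\<dots> = norm (t *\<^sub>R (x + (- inverse t) *\<^sub>R y))"
        using t by (simp only: norm_scaleR abs_of_pos)
      also have "t *\<^sub>R (x + (- inverse t) *\<^sub>R y) = - y + t *\<^sub>R x"
        using t by (simp add: algebra_simps)
      finally show ?thesis by simp
    qed simp
  qed
  moreover obtain h where h: "linear h" "\<And>v. h v \<le> ?q v" "h (- y) = ?q (- y)"
    using Hahn_Banach_finite_dim[OF fin q, of "- y"] by blast
  ultimately have hy: "h y \<le> 0"
    using linear_neg[OF h(1), of y] by simp
  have le: "h v \<le> norm v" for v
    using h(2) straighten_le_self[OF sublinear_norm] by (rule order_trans)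
  obtain f :: "'a \<Rightarrow>\<^sub>L real" where f: "blinfun_apply f = h" "norm f \<le> 1"
    using blinfun_of_dominated_linear[OF h(1) le] by blast
  have "- h x \<le> - norm x"
    using h(2)[of "- x"] straighten_minus_direction[OF sublinear_norm, of x]
      linear_neg[OF h(1), of x] by simp
  then have "f \<in> support_functionals x"
    using le[of x] f x by (intro support_functionalsI) auto
  then show "\<exists>f\<in>support_functionals x. blinfun_apply f y \<le> 0"
    using hy f(1) by auto
next
  assume "\<exists>f\<in>support_functionals x. blinfun_apply f y \<le> 0"
  then obtain f where f: "f \<in> support_functionals x" "blinfun_apply f y \<le> 0" by blast
  show "y \<in> minus_part x"
    unfolding minus_part_def
  proof (intro CollectI allI impI)
    fix t :: real assume t: "t \<le> 0"
    have "norm x \<le> norm x + t * blinfun_apply f y"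
      using mult_nonpos_nonpos[OF t f(2)] by simp
    also have "\<dots> = blinfun_apply f (x + t *\<^sub>R y)"
      using f(1) by (simp add: support_functionals_def blinfun.add_right blinfun.scaleR_right)
    also have "\<dots> \<le> norm (x + t *\<^sub>R y)"
      using f(1) by (intro blinfun_le_norm) (simp add: support_functionals_def)
    finally show "norm (x + t *\<^sub>R y) \<ge> norm x" .
  qed
qed

lemma minus_part_unique_support:
  fixes x :: "'a::real_normed_vector"
  assumes "finite_dim TYPE('a)" "x \<noteq> 0" "support_functionals x = {f}"
  shows "minus_part x = {y. blinfun_apply f y \<le> 0}"
  using minus_part_iff_support[OF assms(1,2)] assms(3) by auto

section \<open>Smooth points and exposed functionals\<close>

text \<open>
  In the step, \<open>G\<close> is corrected by a multiple of the new functional \<open>L j\<close> so that the difference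
  vanishes on the common kernel of the others. The multiplier is read off at a vector \<open>u\<close> of this
  kernel where \<open>L j\<close> does not vanish; if there is none, the multiplier \<open>0\<close> works.
\<close>
lemma functional_in_span_if_kernels_subset:
  fixes G :: "'v::real_vector \<Rightarrow> real" and L :: "'i \<Rightarrow> 'v \<Rightarrow> real"
  assumes "finite I" "\<And>i. i \<in> I \<Longrightarrow> linear (L i)" "linear G"
    and "\<And>v. (\<forall>i\<in>I. L i v = 0) \<Longrightarrow> G v = 0"
  shows "\<exists>c. \<forall>v. G v = (\<Sum>i\<in>I. c i * L i v)"
  using assms
proof (induction I arbitrary: G)
  case empty
  then show ?case by simp
next
  case (insert j I)
  have Lj: "linear (L j)" and L: "\<And>i. i \<in> I \<Longrightarrow> linear (L i)" using insert.prems(1) by auto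
  obtain d where d: "\<And>v. (\<forall>i\<in>I. L i v = 0) \<Longrightarrow> G v = d * L j v"
  proof (cases "\<forall>v. (\<forall>i\<in>I. L i v = 0) \<longrightarrow> L j v = 0")
    case True
    then show ?thesis using that[of 0] insert.prems(3) by simp
  next
    case False
    then obtain u where u: "\<And>i. i \<in> I \<Longrightarrow> L i u = 0" "L j u \<noteq> 0" by blast
    have "G v = (G u / L j u) * L j v" if v: "\<forall>i\<in>I. L i v = 0" for v
    proof -
      let ?w = "v - (L j v / L j u) *\<^sub>R u"
      have "\<forall>i\<in>insert j I. L i ?w = 0"
        using u v L Lj by (auto simp: linear_diff linear_scale)
      then have "G ?w = 0" by (rule insert.prems(3))
      then show ?thesis
        using insert.prems(2) by (simp add: linear_diff linear_scale)
    qed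
    then show ?thesis by (rule that)
  qed
  have "linear (\<lambda>v. G v - d * L j v)"
    using insert.prems(2) Lj
    by (intro linearI) (simp_all add: linear_add linear_scale algebra_simps)
  then obtain c where c: "\<And>v. G v - d * L j v = (\<Sum>i\<in>I. c i * L i v)"
    using insert.IH[of "\<lambda>v. G v - d * L j v"] L d by auto
  have "G v = (\<Sum>i\<in>insert j I. (c(j := d)) i * L i v)" for v
  proof -
    have "(\<Sum>i\<in>I. (c(j := d)) i * L i v) = (\<Sum>i\<in>I. c i * L i v)"
      using insert.hyps by (intro sum.cong) auto
    then show ?thesis using c[of v] insert.hyps by simp
  qed
  then show ?case by blast
qed

text \<open>
  A functional on the space is determined by its values on a finite spanning set, so the evaluations at
  the spanning vectors have trivial common kernel and span the bidual.
\<close>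
lemma finite_dim_reflexive:
  fixes G :: "('a::real_normed_vector \<Rightarrow>\<^sub>L real) \<Rightarrow>\<^sub>L real"
  assumes fin: "finite_dim TYPE('a)"
  shows "\<exists>x. \<forall>f. blinfun_apply G f = blinfun_apply f x"
proof -
  obtain B :: "'a set" where B: "finite B" "span B = UNIV"
    using fin unfolding finite_dim_def by blast
  have "\<exists>c. \<forall>f. blinfun_apply G f = (\<Sum>b\<in>B. c b * blinfun_apply f b)"
  proof (rule functional_in_span_if_kernels_subset[OF B(1)])
    fix b show "linear (\<lambda>f :: 'a \<Rightarrow>\<^sub>L real. blinfun_apply f b)"
      by (intro linearI) (simp_all add: blinfun.add_left blinfun.scaleR_left)
  next
    show "linear (blinfun_apply G)"
      by (intro linearI) (simp_all add: blinfun.add_right blinfun.scaleR_right)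
  next
    fix f :: "'a \<Rightarrow>\<^sub>L real" assume f: "\<forall>b\<in>B. blinfun_apply f b = 0"
    have "blinfun_apply f v = 0" for v
    proof -
      have "linear (blinfun_apply f)"
        by (intro linearI) (simp_all add: blinfun.add_right blinfun.scaleR_right)
      then show ?thesis
        using linear_eq_0_on_span[of "blinfun_apply f" B v] f B(2) by simp
    qed
    then have "f = 0" by (intro blinfun_eqI) simp
    then show "blinfun_apply G f = 0" by (simp add: blinfun.zero_right)
  qed
  then obtain c where "\<And>f. blinfun_apply G f = (\<Sum>b\<in>B. c b * blinfun_apply f b)" by blast
  then have "blinfun_apply G f = blinfun_apply f (\<Sum>b\<in>B. c b *\<^sub>R b)" for f
    by (simp add: blinfun.sum_right blinfun.scaleR_right)
  then show ?thesis by blast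
qed

text \<open>
  The evaluation at \<open>x / norm x\<close> exposes \<open>f\<close>: a norm-one functional at which it takes the value \<open>1\<close> is a
  support functional of \<open>x\<close>.
\<close>
lemma support_of_smooth_exposed:
  fixes x :: "'a::real_normed_vector"
  assumes x: "x \<noteq> 0" and J: "support_functionals x = {f}"
  shows "f \<in> exposed_points_unit_ball"
proof -
  let ?u = "x /\<^sub>R norm x"
  define g where "g = Blinfun (\<lambda>h :: 'a \<Rightarrow>\<^sub>L real. blinfun_apply h ?u)"
  have g: "blinfun_apply g h = blinfun_apply h ?u" for h
    unfolding g_def by (simp add: bounded_linear_Blinfun_apply blinfun.bounded_linear_left)
  have f: "norm f = 1" "blinfun_apply f x = norm x"
    using J by (auto simp: support_functionals_def)
  have g_le: "blinfun_apply g h \<le> 1" if "norm h = 1" for h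
    using blinfun_le_norm[of h ?u] that x by (simp add: g)
  have gf: "blinfun_apply g f = 1"
    using f x by (simp add: g blinfun.scaleR_right)
  have "norm g \<le> 1"
  proof (rule norm_blinfun_bound)
    fix h show "norm (blinfun_apply g h) \<le> 1 * norm h"
      using norm_blinfun[of h ?u] x by (simp add: g)
  qed simp
  moreover have "1 \<le> norm g"
    using norm_blinfun[of g f] f(1) gf by simp
  ultimately have "g \<in> sphere 0 1" by simp
  moreover have "blinfun_apply g h < 1" if h: "h \<in> sphere 0 1 - {f}" for h
  proof (rule ccontr)
    assume "\<not> blinfun_apply g h < 1"
    with g_le[of h] h have "blinfun_apply g h = 1" by simp
    then have "blinfun_apply h x = norm x"
      using x by (simp add: g blinfun.scaleR_right field_simps)
    then have "h \<in> support_functionals x"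
      using h by (simp add: support_functionals_def)
    then show False using h J by simp
  qed
  ultimately show ?thesis
    unfolding exposed_points_unit_ball_def using f(1) gf by (intro CollectI conjI exI[of _ g]) auto
qed

text \<open>
  The exposing functional is an evaluation at a point \<open>x\<close>. A support functional of \<open>x\<close> shows that \<open>norm x \<le> 1\<close>,
  so the members of \<open>J(x)\<close> are exactly the norm-one functionals where the evaluation is \<open>1\<close>.
\<close>
lemma exposed_is_support_of_smooth:
  fixes f :: "'a::real_normed_vector \<Rightarrow>\<^sub>L real"
  assumes fin: "finite_dim TYPE('a)" and f: "f \<in> exposed_points_unit_ball"
  shows "\<exists>x. x \<noteq> 0 \<and> support_functionals x = {f}"
proof -
  obtain G :: "('a \<Rightarrow>\<^sub>L real) \<Rightarrow>\<^sub>L real"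
    where G: "norm G = 1" "blinfun_apply G f = 1"
      and "\<forall>h\<in>sphere 0 1 - {f}. blinfun_apply G h < 1" and nf: "norm f = 1"
    using f unfolding exposed_points_unit_ball_def by auto
  then have less: "blinfun_apply G h < 1" if "norm h = 1" "h \<noteq> f" for h
    using that by simp
  obtain x where x: "\<And>h. blinfun_apply G h = blinfun_apply h x"
    using finite_dim_reflexive[OF fin] by blast
  have x0: "x \<noteq> 0"
    using G(2) x[of f] by (auto simp: blinfun.zero_right)
  have "1 \<le> norm x"
    using blinfun_le_norm[of f x] nf G(2) x[of f] by simp
  moreover obtain h where "h \<in> support_functionals x"
    using support_functionals_nonempty[OF fin x0] by blast
  then have "norm x \<le> 1"
    using blinfun_le_norm[of G h] G(1) x[of h] by (simp add: support_functionals_def)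
  ultimately have nx: "norm x = 1" by simp
  have "support_functionals x = {f}"
  proof (intro subset_antisym subsetI)
    fix h assume "h \<in> support_functionals x"
    then show "h \<in> {f}"
      using less[of h] x[of h] nx by (auto simp: support_functionals_def)
  next
    fix h assume "h \<in> {f}"
    then show "h \<in> support_functionals x"
      using nf G(2) x[of f] nx by (simp add: support_functionals_def)
  qed
  then show ?thesis using x0 by blast
qed

section \<open>Density of the smooth points\<close>

lemma compact_cball_if_compact_sphere:
  fixes x :: "'a::real_normed_vector"
  assumes "compact (sphere (0::'a) 1)"
  shows "compact (cball x e)"
proof (cases "e \<ge> 0")
  case True
  have "cball x e = insert x ((\<lambda>(t, u). x + t *\<^sub>R u) ` ({0..e} \<times> sphere 0 1))"
  proof (intro subset_antisym subsetI)
    fix z assume z: "z \<in> cball x e"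
    show "z \<in> insert x ((\<lambda>(t, u). x + t *\<^sub>R u) ` ({0..e} \<times> sphere 0 1))"
    proof (cases "z = x")
      case False
      then have "z = (\<lambda>(t, u). x + t *\<^sub>R u) (norm (z - x), (z - x) /\<^sub>R norm (z - x))" by simp
      moreover have "(norm (z - x), (z - x) /\<^sub>R norm (z - x)) \<in> {0..e} \<times> sphere 0 1"
        using False z by (auto simp: dist_norm norm_minus_commute)
      ultimately show ?thesis by blast
    qed simp
  next
    fix z assume "z \<in> insert x ((\<lambda>(t, u). x + t *\<^sub>R u) ` ({0..e} \<times> sphere 0 1))"
    then consider "z = x" | t u where "z = x + t *\<^sub>R u" "0 \<le> t" "t \<le> e" "norm u = 1"
      by auto
    then show "z \<in> cball x e"
      using True by cases (simp_all add: dist_norm)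
  qed
  moreover have "compact ((\<lambda>(t, u). x + t *\<^sub>R u) ` ({0..e} \<times> sphere (0::'a) 1))"
  proof (rule compact_continuous_image)
    show "continuous_on ({0..e} \<times> sphere (0::'a) 1) (\<lambda>(t, u). x + t *\<^sub>R u)"
      unfolding case_prod_unfold by (intro continuous_intros)
    show "compact ({0..e} \<times> sphere (0::'a) 1)"
      by (rule compact_Times[OF compact_Icc assms])
  qed
  ultimately show ?thesis by simp
qed simp

text \<open>
  The squares of these functionals add up to a continuous positive definite quadratic form, which
  plays the part of a Euclidean norm.
\<close>
lemma finite_separating_family:
  assumes fin: "finite_dim TYPE('a::real_normed_vector)" and comp: "compact (sphere (0::'a) 1)"
  shows "\<exists>F :: ('a \<Rightarrow>\<^sub>L real) set. finite F \<and> (\<forall>v. v \<noteq> 0 \<longrightarrow> (\<exists>g\<in>F. blinfun_apply g v \<noteq> 0))"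
proof -
  let ?U = "\<lambda>g :: 'a \<Rightarrow>\<^sub>L real. {v. blinfun_apply g v \<noteq> 0}"
  have "open (?U g)" for g
    by (intro open_Collect_neq continuous_intros)
  moreover have "sphere 0 1 \<subseteq> (\<Union>g\<in>UNIV. ?U g)"
  proof
    fix v :: 'a assume v: "v \<in> sphere 0 1"
    then have "v \<noteq> 0" by auto
    then obtain g where "g \<in> support_functionals v"
      using support_functionals_nonempty[OF fin] by blast
    then show "v \<in> (\<Union>g\<in>UNIV. ?U g)"
      using v by (auto simp: support_functionals_def intro!: exI[of _ g])
  qed
  ultimately obtain F where F: "finite F" "sphere 0 1 \<subseteq> (\<Union>g\<in>F. ?U g)"
    by (rule compactE_image[OF comp])
  have "\<exists>g\<in>F. blinfun_apply g v \<noteq> 0" if v: "v \<noteq> 0" for v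
  proof -
    have "v /\<^sub>R norm v \<in> sphere 0 1" using v by simp
    then obtain g where "g \<in> F" "blinfun_apply g (v /\<^sub>R norm v) \<noteq> 0" using F(2) by blast
    then show ?thesis by (auto simp: blinfun.scaleR_right)
  qed
  then show ?thesis using F(1) by blast
qed

text \<open>Two first-order expansions, one below the other and equal at \<open>0\<close>, have the same slope.\<close>
lemma linear_coefficient_unique:
  fixes a b c e :: real
  assumes e: "e > 0" and le: "\<And>t. \<bar>t\<bar> < e \<Longrightarrow> t * a \<le> t * b + t\<^sup>2 * c"
  shows "a = b"
proof -
  have deriv: "((\<lambda>t. t * a - t * b - t\<^sup>2 * c) has_real_derivative (a - b)) (at 0)"
    by (auto intro!: derivative_eq_intros)
  have "\<forall>t. \<bar>0 - t\<bar> < e \<longrightarrow> t * a - t * b - t\<^sup>2 * c \<le> 0 * a - 0 * b - 0\<^sup>2 * c"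
    using le by (auto simp: algebra_simps)
  then have "a - b = 0"
    by (rule DERIV_local_max[OF deriv e])
  then show ?thesis by simp
qed

text \<open>
  The point is a maximiser of \<open>\<phi> z = norm z - k * Q (z - x0)\<close> on a small ball around \<open>x0\<close>. For large \<open>k\<close> the
  penalty keeps the maximiser off the boundary, so that small steps in all directions are allowed.
\<close>
lemma smooth_points_dense:
  fixes x0 :: "'a::real_normed_vector"
  assumes fin: "finite_dim TYPE('a)" and comp: "compact (sphere (0::'a) 1)"
    and x0: "x0 \<noteq> 0" and e: "e > 0"
  shows "\<exists>x\<in>smooth_points. dist x0 x < e"
proof -
  obtain F :: "('a \<Rightarrow>\<^sub>L real) set"
    where F: "finite F" "\<And>v. v \<noteq> 0 \<Longrightarrow> \<exists>g\<in>F. blinfun_apply g v \<noteq> 0"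
    using finite_separating_family[OF fin comp] by blast
  define Q where "Q v = (\<Sum>g\<in>F. (blinfun_apply g v)\<^sup>2)" for v
  define b where "b w v = (\<Sum>g\<in>F. 2 * blinfun_apply g w * blinfun_apply g v)" for w v
  have Q_add: "Q (w + t *\<^sub>R v) = Q w + t * b w v + t\<^sup>2 * Q v" for w v t
    unfolding Q_def b_def sum_distrib_left sum.distrib[symmetric]
    by (intro sum.cong) (simp_all add: blinfun.add_right blinfun.scaleR_right power2_eq_square algebra_simps)
  have Q_pos: "Q v > 0" if v: "v \<noteq> 0" for v
  proof -
    obtain g where "g \<in> F" "blinfun_apply g v \<noteq> 0" using F(2)[OF v] by blast
    then show ?thesis unfolding Q_def using F(1) by (intro sum_pos2[where i = g]) simp_all
  qed
  have Q_cont: "continuous_on S (\<lambda>v. Q (v - x0))" for S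
    unfolding Q_def by (intro continuous_intros)
  \<comment> \<open>The ball of radius \<open>r\<close> avoids the origin, because a smooth point is nonzero.\<close>
  define r where "r = min (e / 2) (norm x0 / 2)"
  have r: "r > 0" "r < e" "r < norm x0"
    using e x0 by (auto simp: r_def min_def)
  have sph: "compact (sphere x0 r)"
  proof -
    have "compact (cball x0 r \<inter> sphere x0 r)"
      unfolding sphere_def
      by (intro compact_Int_closed compact_cball_if_compact_sphere[OF comp] closed_Collect_eq
          continuous_intros)
    moreover have "cball x0 r \<inter> sphere x0 r = sphere x0 r" by auto
    ultimately show ?thesis by simp
  qed
  obtain c where c: "c > 0" "\<And>z. z \<in> sphere x0 r \<Longrightarrow> c \<le> Q (z - x0)"
  proof (cases "sphere x0 r = {}")
    case True
    then show ?thesis using that[of 1] by simp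
  next
    case False
    then obtain z0 where z0: "z0 \<in> sphere x0 r" "\<forall>z\<in>sphere x0 r. Q (z0 - x0) \<le> Q (z - x0)"
      using continuous_attains_inf[OF sph _ Q_cont] by blast
    have "z0 - x0 \<noteq> 0" using z0(1) r(1) by (auto simp: dist_norm)
    then show ?thesis using that[of "Q (z0 - x0)"] Q_pos z0(2) by auto
  qed
  \<comment> \<open>The norm gains at most \<open>r\<close> from \<open>x0\<close> to the boundary, so a penalty above \<open>r\<close> there suffices.\<close>
  define k where "k = (r + 1) / c"
  have k: "k > 0" "k * c > r"
    using c(1) r(1) by (simp_all add: k_def)
  define \<phi> where "\<phi> z = norm z - k * Q (z - x0)" for z
  have "continuous_on (cball x0 r) \<phi>"
    unfolding \<phi>_def by (intro continuous_intros Q_cont)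
  moreover have "cball x0 r \<noteq> {}" using r(1) by auto
  ultimately obtain x where x: "x \<in> cball x0 r" "\<And>z. z \<in> cball x0 r \<Longrightarrow> \<phi> z \<le> \<phi> x"
    using continuous_attains_sup[OF compact_cball_if_compact_sphere[OF comp, of x0 r]] by blast
  have "x \<notin> sphere x0 r"
  proof
    assume s: "x \<in> sphere x0 r"
    have "norm x \<le> norm x0 + r"
      using s norm_triangle_sub[of x x0] by (simp add: dist_norm norm_minus_commute)
    moreover have "r < k * Q (x - x0)"
      using c(2)[OF s] k by (smt (verit) mult_left_mono)
    moreover have "\<phi> x0 = norm x0"
      by (simp add: \<phi>_def Q_def blinfun.zero_right)
    ultimately show False
      using x(2)[of x0] r(1) unfolding \<phi>_def[of x] by simp
  qed
  then have dx: "dist x0 x < r" using x(1) by auto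
  have x_nz: "x \<noteq> 0" using dx r(3) by auto
  \<comment> \<open>Maximality of \<open>x\<close> bounds the norm near \<open>x\<close> by a quadratic polynomial whose linear part is
    \<open>k * b (x - x0) v\<close>; a support functional lies below the norm and must have this same slope.\<close>
  have support_value: "blinfun_apply f v = k * b (x - x0) v" if f: "f \<in> support_functionals x" for f v
  proof (rule linear_coefficient_unique)
    define d where "d = (r - dist x0 x) / (norm v + 1)"
    have d_scale: "d * (norm v + 1) = r - dist x0 x"
      by (simp add: d_def add_nonneg_eq_0_iff)
    show "d > 0" using dx by (simp add: d_def add_nonneg_pos)
    fix t :: real assume t: "\<bar>t\<bar> < d"
    have "\<bar>t\<bar> * norm v \<le> d * (norm v + 1)"
      using t by (intro mult_mono) auto
    then have "x + t *\<^sub>R v \<in> cball x0 r"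
      using norm_triangle_ineq4[of "x0 - x" "t *\<^sub>R v"] d_scale by (simp add: dist_norm algebra_simps)
    then have le: "\<phi> (x + t *\<^sub>R v) \<le> \<phi> x" by (rule x(2))
    have shift: "x + t *\<^sub>R v - x0 = (x - x0) + t *\<^sub>R v" by simp
    have "norm x + t * blinfun_apply f v = blinfun_apply f (x + t *\<^sub>R v)"
      using f by (simp add: support_functionals_def blinfun.add_right blinfun.scaleR_right)
    also have "\<dots> \<le> norm (x + t *\<^sub>R v)"
      using f by (intro blinfun_le_norm) (simp add: support_functionals_def)
    finally show "t * blinfun_apply f v \<le> t * (k * b (x - x0) v) + t\<^sup>2 * (k * Q v)"
      using le unfolding \<phi>_def shift Q_add by (simp add: algebra_simps)
  qed
  obtain f where f: "f \<in> support_functionals x"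
    using support_functionals_nonempty[OF fin x_nz] by blast
  moreover have "g = f" if "g \<in> support_functionals x" for g
    using support_value[OF that] support_value[OF f] by (intro blinfun_eqI) simp
  ultimately have "support_functionals x = {f}" by blast
  then have "x \<in> smooth_points"
    using x_nz by (simp add: smooth_points_def)
  moreover have "dist x0 x < e" using dx r(2) by (rule less_trans)
  ultimately show ?thesis by (rule bexI[rotated])
qed

section \<open>Open balls and one-sided orthogonality\<close>

lemma zero_in_minus_part: "0 \<in> minus_part x"
  by (simp add: minus_part_def)

lemma plus_part_eq_minus_part: "plus_part x = minus_part (- x)"
proof -
  have reflect: "norm (- x + (- t) *\<^sub>R y) = norm (x + t *\<^sub>R y)" for t y
    using norm_minus_cancel[of "x + t *\<^sub>R y"] by (simp add: algebra_simps)
  show ?thesis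
  proof (intro subset_antisym subsetI)
    fix y assume y: "y \<in> plus_part x"
    show "y \<in> minus_part (- x)"
      unfolding minus_part_def
    proof (intro CollectI allI impI)
      fix t :: real assume "t \<le> 0"
      then have "- t \<ge> 0" by simp
      then have "norm x \<le> norm (x + (- t) *\<^sub>R y)"
        using y unfolding plus_part_def by blast
      then show "norm (- x) \<le> norm (- x + t *\<^sub>R y)"
        using reflect[of "- t" y] by simp
    qed
  next
    fix y assume y: "y \<in> minus_part (- x)"
    show "y \<in> plus_part x"
      unfolding plus_part_def
    proof (intro CollectI allI impI)
      fix t :: real assume "t \<ge> 0"
      then have "- t \<le> 0" by simp
      then have "norm (- x) \<le> norm (- x + (- t) *\<^sub>R y)"
        using y unfolding minus_part_def by blast
      then show "norm x \<le> norm (x + t *\<^sub>R y)"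
        using reflect[of t y] by simp
    qed
  qed
qed

lemma not_in_minus_part_iff:
  fixes x y :: "'a::real_normed_vector"
  shows "y \<notin> minus_part x \<longleftrightarrow> (\<exists>s>0. s *\<^sub>R y \<in> ball x (norm x))"
proof
  assume "y \<notin> minus_part x"
  then obtain t where t: "t \<le> 0" "norm (x + t *\<^sub>R y) < norm x"
    by (auto simp: minus_part_def not_le)
  then have "- t > 0" "(- t) *\<^sub>R y \<in> ball x (norm x)"
    by (cases "t = 0"; simp add: dist_norm)+
  then show "\<exists>s>0. s *\<^sub>R y \<in> ball x (norm x)" by blast
next
  assume "\<exists>s>0. s *\<^sub>R y \<in> ball x (norm x)"
  then obtain s where s: "s > 0" "norm (x + (- s) *\<^sub>R y) < norm x"
    by (auto simp: dist_norm)
  then have "- s \<le> 0" by simp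
  with s(2) show "y \<notin> minus_part x"
    unfolding minus_part_def by (metis (mono_tags, lifting) mem_Collect_eq not_less)
qed

lemma not_in_minus_part_scale:
  assumes "r > 0" "r *\<^sub>R y \<in> ball x (norm x)"
  shows "y \<notin> minus_part x"
  using assms by (auto simp: not_in_minus_part_iff)

lemma Inter_minus_part_eq_0_iff:
  "(\<Inter>i\<in>I. minus_part (x i)) = {0} \<longleftrightarrow> (\<forall>y. y \<noteq> 0 \<longrightarrow> (\<exists>i\<in>I. y \<notin> minus_part (x i)))"
  using zero_in_minus_part by blast

text \<open>
  Enlarging the factor moves the centre by exactly as much as it enlarges \<open>s * norm y\<close>, and the deduction \<open>1 / s\<close>
  shrinks. The deduction is the room in which the centres can later be moved.
\<close>
lemma ball_dilation_mono:
  fixes y :: "'a::real_normed_vector"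
  assumes "0 < s" "s \<le> s'"
  shows "ball (s *\<^sub>R y) (s * norm y - 1 / s) \<subseteq> ball (s' *\<^sub>R y) (s' * norm y - 1 / s')"
proof
  fix a assume "a \<in> ball (s *\<^sub>R y) (s * norm y - 1 / s)"
  moreover have "dist (s' *\<^sub>R y) (s *\<^sub>R y) = (s' - s) * norm y"
    using assms by (simp add: dist_norm flip: scaleR_diff_left)
  moreover have "1 / s' \<le> 1 / s"
    using assms by (simp add: frac_le)
  ultimately show "a \<in> ball (s' *\<^sub>R y) (s' * norm y - 1 / s')"
    using dist_triangle[of "s' *\<^sub>R y" a "s *\<^sub>R y"] by (simp add: algebra_simps)
qed

text \<open>
  A point whose multiple lies in \<open>B(y i, norm (y i))\<close> keeps a positive distance \<open>\<delta>\<close> from the boundary of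
  all larger dilations of that ball, so it survives the deduction \<open>1 / s\<close> once \<open>1 / s < \<delta>\<close>. The
  dilated families grow with \<open>s\<close>, so a finite subcover reduces to its largest factor.
\<close>
lemma compact_covered_by_dilated_balls:
  fixes y :: "'i \<Rightarrow> 'a::real_normed_vector"
  assumes K: "compact K" and out: "\<And>a. a \<in> K \<Longrightarrow> \<exists>i\<in>I. a \<notin> minus_part (y i)"
  shows "\<exists>s>0. K \<subseteq> (\<Union>i\<in>I. ball (s *\<^sub>R y i) (s * norm (y i) - 1 / s))"
proof -
  let ?U = "\<lambda>s. \<Union>i\<in>I. ball (s *\<^sub>R y i) (s * norm (y i) - 1 / s)"
  have "K \<subseteq> (\<Union>s\<in>{0<..}. ?U s)"
  proof
    fix a assume "a \<in> K"
    then obtain i t where i: "i \<in> I" and t: "t > 0" and lt: "norm (y i - t *\<^sub>R a) < norm (y i)"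
      using out not_in_minus_part_iff by (metis dist_norm mem_ball)
    define \<delta> where "\<delta> = (norm (y i) - norm (y i - t *\<^sub>R a)) / t"
    have \<delta>: "\<delta> > 0" using lt t by (simp add: \<delta>_def)
    \<comment> \<open>The factor \<open>1 / t\<close> brings \<open>a\<close> into the dilated ball; \<open>2 / \<delta>\<close> makes the deduction smaller than \<open>\<delta>\<close>.\<close>
    define s where "s = max (1 / t) (2 / \<delta>)"
    have s: "s > 0" "s \<ge> 1 / t" "1 / s < \<delta>"
      using t \<delta> by (auto simp: s_def field_simps max_def)
    have "norm (s *\<^sub>R y i - a) = norm ((1 / t) *\<^sub>R (y i - t *\<^sub>R a) + (s - 1 / t) *\<^sub>R y i)"
      using t by (simp add: algebra_simps)
    also have "\<dots> \<le> norm (y i - t *\<^sub>R a) / t + (s - 1 / t) * norm (y i)"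
      using norm_triangle_ineq[of "(1 / t) *\<^sub>R (y i - t *\<^sub>R a)" "(s - 1 / t) *\<^sub>R y i"] s t by simp
    also have "\<dots> = s * norm (y i) - \<delta>"
      using t by (simp add: \<delta>_def field_simps)
    also have "\<dots> < s * norm (y i) - 1 / s"
      using s(3) by simp
    finally show "a \<in> (\<Union>s\<in>{0<..}. ?U s)"
      using i s(1) by (auto simp: dist_norm)
  qed
  moreover have "open (?U s)" for s by auto
  ultimately obtain T where T: "T \<subseteq> {0<..}" "finite T" "K \<subseteq> (\<Union>s\<in>T. ?U s)"
    using compactE_image[OF K, of "{0<..}" ?U] by blast
  define s where "s = Max (insert 1 T)"
  have s: "s > 0" "\<And>t. t \<in> T \<Longrightarrow> t \<le> s"
    using T(2) Max_ge[of "insert 1 T"] by (auto simp: s_def intro: less_le_trans[of 0 1])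
  have "K \<subseteq> ?U s"
  proof
    fix a assume "a \<in> K"
    then obtain t i where "t \<in> T" "i \<in> I" "a \<in> ball (t *\<^sub>R y i) (t * norm (y i) - 1 / t)"
      using T(3) by blast
    then show "a \<in> ?U s"
      using ball_dilation_mono[of t s "y i"] s(2) T(1) by blast
  qed
  then show ?thesis using s(1) by blast
qed

text \<open>
  Moving a centre by less than \<open>1 / (2 * s)\<close> costs that much in the distance to the covered points and again
  in the norm of the centre; together this is at most the room \<open>1 / s\<close> left by the shrunken radii.
\<close>
lemma smooth_centres_exist:
  fixes y :: "'i \<Rightarrow> 'a::real_normed_vector"
  assumes fin: "finite_dim TYPE('a)" and comp: "compact (sphere (0::'a) 1)"
    and nz: "\<And>i. i \<in> I \<Longrightarrow> y i \<noteq> 0" and y: "(\<Inter>i\<in>I. minus_part (y i)) = {0}"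
  shows "\<exists>x :: 'i \<Rightarrow> 'a. (\<forall>i\<in>I. x i \<in> smooth_points) \<and> (\<Inter>i\<in>I. minus_part (x i)) = {0}"
proof -
  have "\<exists>i\<in>I. a \<notin> minus_part (y i)" if "a \<in> sphere 0 1" for a
  proof -
    have "a \<noteq> 0" using that by auto
    then show ?thesis using y unfolding Inter_minus_part_eq_0_iff by blast
  qed
  then obtain s where s: "s > 0"
    and cov: "sphere 0 1 \<subseteq> (\<Union>i\<in>I. ball (s *\<^sub>R y i) (s * norm (y i) - 1 / s))"
    using compact_covered_by_dilated_balls[OF comp] by blast
  have "\<forall>i\<in>I. \<exists>x\<in>smooth_points. dist (s *\<^sub>R y i) x < 1 / (2 * s)"
    using s nz by (intro ballI smooth_points_dense[OF fin comp]) auto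
  then obtain x where x: "\<And>i. i \<in> I \<Longrightarrow> x i \<in> smooth_points"
    "\<And>i. i \<in> I \<Longrightarrow> dist (s *\<^sub>R y i) (x i) < 1 / (2 * s)"
    by metis
  have out: "\<exists>i\<in>I. v \<notin> minus_part (x i)" if v: "v \<noteq> 0" for v
  proof -
    let ?a = "inverse (norm v) *\<^sub>R v"
    have "?a \<in> sphere 0 1" using v by simp
    then obtain i where i: "i \<in> I" "?a \<in> ball (s *\<^sub>R y i) (s * norm (y i) - 1 / s)"
      using cov by blast
    have "dist (x i) ?a < 1 / (2 * s) + (s * norm (y i) - 1 / s)"
      using x(2)[OF i(1)] i(2) dist_triangle[of "x i" ?a "s *\<^sub>R y i"] by (simp add: dist_commute)
    moreover have "s * norm (y i) \<le> norm (x i) + 1 / (2 * s)"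
      using x(2)[OF i(1)] norm_triangle_sub[of "s *\<^sub>R y i" "x i"] s by (simp add: dist_norm)
    moreover have "1 / (2 * s) + 1 / (2 * s) = 1 / s" by simp
    ultimately have "?a \<in> ball (x i) (norm (x i))" by simp
    then show ?thesis
      using not_in_minus_part_scale[of "inverse (norm v)" v "x i"] v i(1) by auto
  qed
  show ?thesis
    unfolding Inter_minus_part_eq_0_iff
    by (rule exI[of _ x]) (simp add: x(1) out)
qed

lemma ball_covering_iff_minus_parts:
  fixes A :: "'a::real_normed_vector set"
  assumes A: "0 \<notin> A" "compact A" and rays: "\<And>v. v \<noteq> 0 \<Longrightarrow> \<exists>r>0. r *\<^sub>R v \<in> A"
  shows "admits_ball_covering m A \<longleftrightarrow>
    (\<exists>y :: nat \<Rightarrow> 'a. (\<forall>i\<in>{1..m}. y i \<noteq> 0) \<and> (\<Inter>i\<in>{1..m}. minus_part (y i)) = {0})"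
proof
  assume "admits_ball_covering m A"
  then obtain x r where x: "\<And>i. i \<in> {1..m} \<Longrightarrow> x i \<noteq> 0 \<and> 0 < r i \<and> r i \<le> norm (x i)"
    and cov: "A \<subseteq> (\<Union>i\<in>{1..m}. ball (x i) (r i))"
    unfolding admits_ball_covering_def by blast
  have "\<exists>i\<in>{1..m}. v \<notin> minus_part (x i)" if "v \<noteq> 0" for v
  proof -
    obtain t where t: "t > 0" "t *\<^sub>R v \<in> A" using rays \<open>v \<noteq> 0\<close> by blast
    then obtain i where i: "i \<in> {1..m}" "t *\<^sub>R v \<in> ball (x i) (r i)" using cov by blast
    then have "t *\<^sub>R v \<in> ball (x i) (norm (x i))"
      using x[OF i(1)] by auto
    then show ?thesis using not_in_minus_part_scale[OF t(1)] i(1) by blast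
  qed
  then show "\<exists>y :: nat \<Rightarrow> 'a. (\<forall>i\<in>{1..m}. y i \<noteq> 0) \<and> (\<Inter>i\<in>{1..m}. minus_part (y i)) = {0}"
    unfolding Inter_minus_part_eq_0_iff using x by blast
next
  assume "\<exists>y :: nat \<Rightarrow> 'a. (\<forall>i\<in>{1..m}. y i \<noteq> 0) \<and> (\<Inter>i\<in>{1..m}. minus_part (y i)) = {0}"
  then obtain y :: "nat \<Rightarrow> 'a" where y: "\<And>i. i \<in> {1..m} \<Longrightarrow> y i \<noteq> 0"
    "\<And>v. v \<noteq> 0 \<Longrightarrow> \<exists>i\<in>{1..m}. v \<notin> minus_part (y i)"
    unfolding Inter_minus_part_eq_0_iff by blast
  have "\<exists>i\<in>{1..m}. a \<notin> minus_part (y i)" if "a \<in> A" for a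
    using that A(1) by (intro y(2)) auto
  then obtain s where s: "s > 0"
    and cov: "A \<subseteq> (\<Union>i\<in>{1..m}. ball (s *\<^sub>R y i) (s * norm (y i) - 1 / s))"
    using compact_covered_by_dilated_balls[OF A(2)] by blast
  have "ball (s *\<^sub>R y i) (s * norm (y i) - 1 / s) \<subseteq> ball (s *\<^sub>R y i) (s * norm (y i))" for i
    using s by (intro subset_ball) simp
  then have "A \<subseteq> (\<Union>i\<in>{1..m}. ball (s *\<^sub>R y i) (s * norm (y i)))"
    using cov by blast
  then show "admits_ball_covering m A"
    unfolding admits_ball_covering_def using s y(1)
    by (intro exI[of _ "\<lambda>i. s *\<^sub>R y i"] exI[of _ "\<lambda>i. s * norm (y i)"]) auto
qed

lemma compact_sphere_if_compact_ray_transversal: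
  fixes A :: "'a::real_normed_vector set"
  assumes A: "0 \<notin> A" "compact A" and rays: "\<And>v. v \<noteq> 0 \<Longrightarrow> \<exists>r>0. r *\<^sub>R v \<in> A"
  shows "compact (sphere (0::'a) 1)"
proof -
  have "sphere 0 1 = (\<lambda>a. a /\<^sub>R norm a) ` A"
  proof (intro subset_antisym subsetI)
    fix u :: 'a assume u: "u \<in> sphere 0 1"
    then have "u \<noteq> 0" by auto
    then obtain r where "r > 0" "r *\<^sub>R u \<in> A" using rays by blast
    moreover from this have "u = (r *\<^sub>R u) /\<^sub>R norm (r *\<^sub>R u)" using u by simp
    ultimately show "u \<in> (\<lambda>a. a /\<^sub>R norm a) ` A" by blast
  next
    fix u assume "u \<in> (\<lambda>a. a /\<^sub>R norm a) ` A"
    then obtain a where "a \<in> A" "u = a /\<^sub>R norm a" by blast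
    moreover from this have "norm a \<noteq> 0" using A(1) by auto
    ultimately show "u \<in> sphere 0 1" by simp
  qed
  moreover have "continuous_on A (\<lambda>a. a /\<^sub>R norm a)"
    using A(1) by (intro continuous_intros) auto
  ultimately show ?thesis using compact_continuous_image A(2) by metis
qed

lemma smooth_minus_parts_iff_exposed_half_spaces:
  fixes I :: "'i set"
  assumes fin: "finite_dim TYPE('a::real_normed_vector)"
  shows "(\<exists>x :: 'i \<Rightarrow> 'a. (\<forall>i\<in>I. x i \<in> smooth_points) \<and> (\<Inter>i\<in>I. minus_part (x i)) = {0}) \<longleftrightarrow>
    (\<exists>f :: 'i \<Rightarrow> 'a \<Rightarrow>\<^sub>L real. (\<forall>i\<in>I. f i \<in> exposed_points_unit_ball) \<and>
       (\<Inter>i\<in>I. {y. blinfun_apply (f i) y \<le> 0}) = {0})"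
proof
  assume "\<exists>x :: 'i \<Rightarrow> 'a. (\<forall>i\<in>I. x i \<in> smooth_points) \<and> (\<Inter>i\<in>I. minus_part (x i)) = {0}"
  then obtain x :: "'i \<Rightarrow> 'a" where x: "\<forall>i\<in>I. x i \<in> smooth_points"
    "(\<Inter>i\<in>I. minus_part (x i)) = {0}"
    by (elim exE conjE) (rule that)
  have "\<forall>i\<in>I. \<exists>f. x i \<noteq> 0 \<and> support_functionals (x i) = {f}"
    using x(1) by (simp add: smooth_points_def is_singleton_def)
  then obtain f where f: "\<And>i. i \<in> I \<Longrightarrow> x i \<noteq> 0 \<and> support_functionals (x i) = {f i}" by metis
  then have "(\<Inter>i\<in>I. minus_part (x i)) = (\<Inter>i\<in>I. {y. blinfun_apply (f i) y \<le> 0})"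
    using minus_part_unique_support[OF fin] by (intro INF_cong) auto
  then show "\<exists>f :: 'i \<Rightarrow> 'a \<Rightarrow>\<^sub>L real. (\<forall>i\<in>I. f i \<in> exposed_points_unit_ball) \<and>
      (\<Inter>i\<in>I. {y. blinfun_apply (f i) y \<le> 0}) = {0}"
  proof (intro exI[of _ f] conjI ballI)
    show "f i \<in> exposed_points_unit_ball" if "i \<in> I" for i
      using f[OF that] support_of_smooth_exposed[of "x i" "f i"] by blast
  qed (use x(2) in simp)
next
  assume "\<exists>f :: 'i \<Rightarrow> 'a \<Rightarrow>\<^sub>L real. (\<forall>i\<in>I. f i \<in> exposed_points_unit_ball) \<and>
      (\<Inter>i\<in>I. {y. blinfun_apply (f i) y \<le> 0}) = {0}"
  then obtain f :: "'i \<Rightarrow> 'a \<Rightarrow>\<^sub>L real" where f: "\<forall>i\<in>I. f i \<in> exposed_points_unit_ball"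
    "(\<Inter>i\<in>I. {y. blinfun_apply (f i) y \<le> 0}) = {0}"
    by (elim exE conjE) (rule that)
  have "\<forall>i\<in>I. \<exists>x. x \<noteq> 0 \<and> support_functionals x = {f i}"
    using f(1) exposed_is_support_of_smooth[OF fin] by blast
  then obtain x where x: "\<And>i. i \<in> I \<Longrightarrow> x i \<noteq> 0 \<and> support_functionals (x i) = {f i}" by metis
  then have "(\<Inter>i\<in>I. minus_part (x i)) = (\<Inter>i\<in>I. {y. blinfun_apply (f i) y \<le> 0})"
    using minus_part_unique_support[OF fin] by (intro INF_cong) auto
  then show "\<exists>x :: 'i \<Rightarrow> 'a. (\<forall>i\<in>I. x i \<in> smooth_points) \<and> (\<Inter>i\<in>I. minus_part (x i)) = {0}"
    using f(2) x by (intro exI[of _ x]) (auto simp: smooth_points_def)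
qed

section \<open>The equivalences\<close>

theorem lemma3p21:
  fixes A :: "'a::banach set" and m :: nat
  assumes "finite_dim TYPE('a)"
    and "\<exists>x::'a. x \<noteq> 0"
    and "m \<ge> 1"
    and "A \<subseteq> UNIV - {0}"
    and "compact A"
    and "\<forall>x::'a. x \<noteq> 0 \<longrightarrow> (\<exists>r::real. r > 0 \<and> r *\<^sub>R x \<in> A)"
  defines "cond_i \<equiv> admits_ball_covering m A"
    and "cond_ii \<equiv> \<exists>x :: nat \<Rightarrow> 'a. (\<forall>i\<in>{1..m}. x i \<in> smooth_points) \<and>
                      (\<Inter>i\<in>{1..m}. minus_part (x i)) = {0}"
    and "cond_iii \<equiv> \<exists>y :: nat \<Rightarrow> 'a. (\<forall>i\<in>{1..m}. y i \<noteq> 0) \<and>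
                      (\<Inter>i\<in>{1..m}. minus_part (y i)) = {0}"
    and "cond_iv \<equiv> \<exists>z :: nat \<Rightarrow> 'a. (\<forall>i\<in>{1..m}. z i \<noteq> 0) \<and>
                      (\<Inter>i\<in>{1..m}. plus_part (z i)) = {0}"
    and "cond_v \<equiv> \<exists>f :: nat \<Rightarrow> 'a \<Rightarrow>\<^sub>L real. (\<forall>i\<in>{1..m}. f i \<in> exposed_points_unit_ball) \<and>
                      (\<Inter>i\<in>{1..m}. {y::'a. blinfun_apply (f i) y \<le> 0}) = {0}"
  shows "(cond_i \<longleftrightarrow> cond_ii) \<and> (cond_i \<longleftrightarrow> cond_iii) \<and>
         (cond_i \<longleftrightarrow> cond_iv) \<and> (cond_i \<longleftrightarrow> cond_v)"
proof -
  have A: "0 \<notin> A" "compact A" and rays: "\<And>v. v \<noteq> 0 \<Longrightarrow> \<exists>r>0. r *\<^sub>R v \<in> A"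
    using assms(4-6) by auto
  have comp: "compact (sphere (0::'a) 1)"
    by (rule compact_sphere_if_compact_ray_transversal[OF A rays])
  have i_iii: "cond_i \<longleftrightarrow> cond_iii"
    unfolding cond_i_def cond_iii_def by (rule ball_covering_iff_minus_parts[OF A rays])
  have ii_iii: "cond_ii \<longleftrightarrow> cond_iii"
  proof
    assume cond_ii
    then show cond_iii
      unfolding cond_ii_def cond_iii_def smooth_points_def by blast
  next
    assume cond_iii
    then obtain y :: "nat \<Rightarrow> 'a" where "\<forall>i\<in>{1..m}. y i \<noteq> 0" "(\<Inter>i\<in>{1..m}. minus_part (y i)) = {0}"
      unfolding cond_iii_def by blast
    then show cond_ii
      unfolding cond_ii_def by (intro smooth_centres_exist[OF assms(1) comp]) auto
  qed
  have iii_iv: "cond_iii \<longleftrightarrow> cond_iv"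
  proof
    assume cond_iii
    then obtain y :: "nat \<Rightarrow> 'a" where "\<forall>i\<in>{1..m}. y i \<noteq> 0" "(\<Inter>i\<in>{1..m}. minus_part (y i)) = {0}"
      unfolding cond_iii_def by blast
    then show cond_iv
      unfolding cond_iv_def plus_part_eq_minus_part by (intro exI[of _ "\<lambda>i. - y i"]) auto
  next
    assume cond_iv
    then obtain z :: "nat \<Rightarrow> 'a" where "\<forall>i\<in>{1..m}. z i \<noteq> 0" "(\<Inter>i\<in>{1..m}. minus_part (- z i)) = {0}"
      unfolding cond_iv_def plus_part_eq_minus_part by blast
    then show cond_iii
      unfolding cond_iii_def by (intro exI[of _ "\<lambda>i. - z i"]) auto
  qed
  have "cond_ii \<longleftrightarrow> cond_v"
    unfolding cond_ii_def cond_v_def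
    by (rule smooth_minus_parts_iff_exposed_half_spaces[OF assms(1)])
  then show ?thesis
    using i_iii ii_iii iii_iv by simp
qed

end
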